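(* Let $X=V(f)\subset\mathbb P^n_{\mathbf w}$ be a weighted hypersurface over $\mathbb F_q$, let $d=\gcd(w_0,\dots,w_n)$, $\mathbf w'=\mathbf w/d$, and let $X'=V(f)\subset\mathbb P^n_{\mathbf w'}$ be the same hypersurface for the reduced weights. Each of $H^{\mathrm{stack},\deg}_{\mathbf w,q}$ and $H^{\mathrm{stack},\mathrm{ff}}_{\mathbf w,q}$ is invariant under reduction of the weights: for corresponding points $\mathbf x$ of $X$ and $\mathbf x'$ of $X'$ (points over $\overline{\mathbb F}_q$ in the first case, points over $K=\mathbb F_q(t)$ in the second), $$H^{\mathrm{stack},\deg}_{\mathbf w',q}(\mathbf x')=H^{\mathrm{stack},\deg}_{\mathbf w,q}(\mathbf x),\qquad H^{\mathrm{stack},\mathrm{ff}}_{\mathbf w',q}(\mathbf x')=H^{\mathrm{stack},\mathrm{ff}}_{\mathbf w,q}(\mathbf x).$$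
   Context: $q$ is a prime power, $\mathbf w=(w_0,\dots,w_n)$ positive integers. $\mathbb P^n_{\mathbf w}$ is the weighted projective space (quotient of $\mathbb A^{n+1}\setminus\{0\}$ by $\lambda\cdot(x_i)=(\lambda^{w_i}x_i)$); $f$ is weighted homogeneous over $\mathbb F_q$. $\mathbb P^n_{\mathbf w}$ and $\mathbb P^n_{\mathbf w'}$ are isomorphic coarse varieties; corresponding points $\mathbf x,\mathbf x'$ are those represented by the same coordinate vector. $S(\mathbf x)=\{i:x_i\ne0\}$ and $k_S=\gcd(w_i:i\in S)$ (for the weights $\mathbf w'$, $k_S$ is replaced by $k_S/d$); $|\mathrm{Aut}(\mathbf x)|=k_{S(\mathbf x)}$ is the order of the geometric stabilizer $\mu_{k_{S(\mathbf x)}}$. Degree-based height: for $\mathbf x\in X(\overline{\mathbb F}_q)$, $r_{\mathbf x}$ is the least $r\ge1$ such that $\mathbf x$ has a representative over $\mathbb F_{q^r}$, $\deg(a)=[\mathbb F_q(a):\mathbb F_q]$ (so $\deg(0)=1$), and $H^{\deg}_{\mathbf w,q}(\mathbf x)=r_{\mathbf x}\min_{\lambda\in\overline{\mathbb F}_q^\times}\max_i\deg(\lambda^{w_i}x_i)/w_i$. Function-field height: for $\mathbf x\in X_K(K)$ (points of the coarse variety, $X_K=X\times_{\mathbb F_q}K$) with representative $\tilde{\mathbf x}\in K^{n+1}\setminus\{0\}$, $H^{\mathrm{ff}}_{\mathbf w,q}(\mathbf x)=\sum_v\max_i\log|\tilde x_i|_v/w_i$ over all places $v$ of $K$, with $|a|_v=q^{-\deg(v)\mathrm{ord}_v(a)}$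 and $\log|0|_v=-\infty$. $H^{\mathrm{stack},\deg}_{\mathbf w,q}(\mathbf x)=|\mathrm{Aut}(\mathbf x)|\,H^{\deg}_{\mathbf w,q}(\mathbf x)$ for $\mathbf x\in X(\overline{\mathbb F}_q)$, and $H^{\mathrm{stack},\mathrm{ff}}_{\mathbf w,q}(\mathbf x)=|\mathrm{Aut}(\mathbf x)|\,H^{\mathrm{ff}}_{\mathbf w,q}(\mathbf x)$ for $\mathbf x\in X_K(K)$. *)

theory Defs
  imports
    "HOL-Analysis.Analysis"
    "HOL-Algebra.Algebraic_Closure_Type"
    "HOL-Algebra.Embedded_Algebras"
    "HOL-Algebra.Generated_Fields"
    "HOL-Algebra.QuotRing"
    "HOL-Computational_Algebra.Fraction_Field"
    "HOL-Library.Poly_Mapping"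
begin

no_notation fps_nth (infixl \<open>$\<close> 75)

text \<open>
  The finite field \<open>\<bbbF>\<^sub>q\<close> is a type \<open>'a\<close> of sort \<open>{field, finite}\<close> with \<open>q = CARD('a)\<close>; its
  algebraic closure is \<open>'a alg_closure\<close>, and \<open>K = \<bbbF>\<^sub>q(t)\<close> is \<open>'a poly fract\<close>. The homogeneous
  coordinates are indexed by a finite type \<open>'n\<close>, so \<open>n + 1 = CARD('n)\<close>.
\<close>

section \<open>Weighted projective space\<close>

definition wrel :: "('n::finite \<Rightarrow> nat) \<Rightarrow> (('k::field ^ 'n) \<times> ('k ^ 'n)) set" where
  "wrel w = {(x, y). x \<noteq> 0 \<and> y \<noteq> 0 \<and> (\<exists>c. c \<noteq> 0 \<and> (\<forall>i. y $ i = c ^ w i * x $ i))}"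

text \<open>
  The points over an algebraically closed field \<open>'k\<close>. A point is the set of all its
  representatives.
\<close>

definition wproj :: "('n::finite \<Rightarrow> nat) \<Rightarrow> ('k::alg_closed_field ^ 'n) set set" where
  "wproj w = (UNIV - {0}) // wrel w"

definition corresponding :: "('k::field ^ 'n::finite) set \<Rightarrow> ('k ^ 'n) set \<Rightarrow> bool" where
  "corresponding P P' \<longleftrightarrow> (\<exists>x. x \<in> P \<and> x \<in> P')"

section \<open>Weighted hypersurfaces\<close>

text \<open>
  A polynomial in the variables \<open>'n\<close> over \<open>'a\<close> is a finitely supported map from exponent
  vectors to coefficients.
\<close>

type_synonym ('n, 'a) mpolynomial = "('n \<Rightarrow>\<^sub>0 nat) \<Rightarrow>\<^sub>0 'a"

definition mpoly_eval ::
  "('a::zero \<Rightarrow> 'k::comm_ring_1) \<Rightarrow> ('n::finite, 'a) mpolynomial \<Rightarrow> 'k ^ 'n \<Rightarrow> 'k" where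
  "mpoly_eval \<iota> f x =
     (\<Sum>m\<in>Poly_Mapping.keys f. \<iota> (Poly_Mapping.lookup f m) * (\<Prod>i\<in>UNIV. (x $ i) ^ Poly_Mapping.lookup m i))"

definition weighted_homogeneous ::
  "('n::finite \<Rightarrow> nat) \<Rightarrow> ('n, 'a::zero) mpolynomial \<Rightarrow> bool" where
  "weighted_homogeneous w f \<longleftrightarrow> (\<exists>D. \<forall>m\<in>Poly_Mapping.keys f. (\<Sum>i\<in>UNIV. w i * Poly_Mapping.lookup m i) = D)"

text \<open>
  The points of \<open>V(f)\<close> over an algebraically closed field \<open>'k\<close>, where \<open>\<iota>\<close> embeds the
  coefficients of \<open>f\<close> into \<open>'k\<close>.
\<close>

definition hypersurface_points ::
  "('a::zero \<Rightarrow> 'k::alg_closed_field) \<Rightarrow> ('n::finite \<Rightarrow> nat) \<Rightarrow> ('n, 'a) mpolynomial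
     \<Rightarrow> ('k ^ 'n) set set" where
  "hypersurface_points \<iota> w f = {P \<in> wproj w. \<forall>x\<in>P. mpoly_eval \<iota> f x = 0}"

definition hypersurface_Fqbar ::
  "('n::finite \<Rightarrow> nat) \<Rightarrow> ('n, 'a::{field, finite}) mpolynomial
     \<Rightarrow> ('a alg_closure ^ 'n) set set" where
  "hypersurface_Fqbar w f = hypersurface_points to_ac w f"

definition const_K :: "'a::field \<Rightarrow> 'a poly fract" where
  "const_K c = Fract [:c:] 1"

definition geometric_vec :: "'k::field ^ 'n::finite \<Rightarrow> 'k alg_closure ^ 'n" where
  "geometric_vec x = (\<chi> i. to_ac (x $ i))"

text \<open>
  The \<open>K\<close>-points of the coarse variety are the points over the algebraic closure of \<open>K\<close> that
  have a representative in \<open>K\<^sup>n\<^sup>+\<^sup>1\<close>. In particular, two vectors over \<open>K\<close> represent the same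
  \<open>K\<close>-point as soon as they are equivalent under a scalar from the algebraic closure; this is in
  general coarser than equivalence under scalars from \<open>K\<close>.
\<close>

definition hypersurface_K ::
  "('n::finite \<Rightarrow> nat) \<Rightarrow> ('n, 'a::{field, finite}) mpolynomial
     \<Rightarrow> ('a poly fract alg_closure ^ 'n) set set" where
  "hypersurface_K w f =
     {P \<in> hypersurface_points (\<lambda>c. to_ac (const_K c)) w f. \<exists>x. geometric_vec x \<in> P}"

section \<open>Stabilizers\<close>

text \<open>
  All representatives of a point have the same support. The order is that of the group scheme
  \<open>\<mu>\<^sub>k\<close>, so it is \<open>k\<close> even if the characteristic divides \<open>k\<close>.
\<close>

definition supp :: "('k::field ^ 'n::finite) set \<Rightarrow> 'n set" where
  "supp P = {i. \<exists>x\<in>P. x $ i \<noteq> 0}"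

definition aut_order :: "('n::finite \<Rightarrow> nat) \<Rightarrow> ('k::field ^ 'n) set \<Rightarrow> nat" where
  "aut_order w P = Gcd (w ` supp P)"

section \<open>Degree-based height\<close>

definition field_degree :: "'a::{field, finite} alg_closure \<Rightarrow> nat" where
  "field_degree a =
     ring.dim ring_of_type_algebra (range to_ac)
       (generate_field ring_of_type_algebra (insert a (range to_ac)))"

text \<open>\<open>F\<close> below is the unique subfield of the algebraic closure with \<open>q\<^sup>r\<close> elements.\<close>

definition min_field_exponent :: "('a::{field, finite} alg_closure ^ 'n::finite) set \<Rightarrow> nat" where
  "min_field_exponent P =
     (LEAST r. 1 \<le> r \<and>
        (\<exists>F. subfield F ring_of_type_algebra \<and> card F = CARD('a) ^ r \<and>
          (\<exists>y\<in>P. \<forall>i. y $ i \<in> F)))"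

text \<open>
  The minimum is attained, since the values are natural multiples of a fixed positive rational
  number; and it is the same for all representatives of a point.
\<close>

definition min_scaled_degree ::
  "('n::finite \<Rightarrow> nat) \<Rightarrow> 'a::{field, finite} alg_closure ^ 'n \<Rightarrow> real" where
  "min_scaled_degree w x =
     (LEAST h. \<exists>c. c \<noteq> 0 \<and>
        h = Max (range (\<lambda>i. real (field_degree (c ^ w i * x $ i)) / real (w i))))"

definition height_deg ::
  "('n::finite \<Rightarrow> nat) \<Rightarrow> ('a::{field, finite} alg_closure ^ 'n) set \<Rightarrow> real" where
  "height_deg w P = real (min_field_exponent P) * min_scaled_degree w (SOME x. x \<in> P)"

definition stack_height_deg ::
  "('n::finite \<Rightarrow> nat) \<Rightarrow> ('a::{field, finite} alg_closure ^ 'n) set \<Rightarrow> real" where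
  "stack_height_deg w P = real (aut_order w P) * height_deg w P"

section \<open>Function-field height\<close>

text \<open>
  A place of \<open>K\<close> is given by its normalized discrete valuation \<open>ord\<^sub>v\<close>. The value
  \<open>ord\<^sub>v(0) = \<infinity>\<close> is replaced by the dummy value \<open>0\<close>, which is never used. Triviality on the
  constants is automatic, as these are finite in number.
\<close>

definition places :: "('a::{field, finite} poly fract \<Rightarrow> int) set" where
  "places = {v. v 0 = 0 \<and>
     (\<forall>a b. a \<noteq> 0 \<longrightarrow> b \<noteq> 0 \<longrightarrow> v (a * b) = v a + v b) \<and>
     (\<forall>a b. a \<noteq> 0 \<longrightarrow> b \<noteq> 0 \<longrightarrow> a + b \<noteq> 0 \<longrightarrow> min (v a) (v b) \<le> v (a + b)) \<and>
     v ` (UNIV - {0}) = UNIV}"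

definition valuation_ring ::
  "('a::{field, finite} poly fract \<Rightarrow> int) \<Rightarrow> 'a poly fract ring" where
  "valuation_ring v = ring_of_type_algebra\<lparr>carrier := {a. a = 0 \<or> 0 \<le> v a}\<rparr>"

definition valuation_ideal ::
  "('a::{field, finite} poly fract \<Rightarrow> int) \<Rightarrow> 'a poly fract set" where
  "valuation_ideal v = {a. a = 0 \<or> 0 < v a}"

text \<open>The degree of a place is the dimension of its residue field over the image of \<open>\<bbbF>\<^sub>q\<close>.\<close>

definition place_degree :: "('a::{field, finite} poly fract \<Rightarrow> int) \<Rightarrow> nat" where
  "place_degree v =
     ring.dim (valuation_ring v Quot valuation_ideal v)
       (range (\<lambda>c. a_r_coset (valuation_ring v) (valuation_ideal v) (const_K c)))
       (carrier (valuation_ring v Quot valuation_ideal v))"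

definition abs_place ::
  "('a::{field, finite} poly fract \<Rightarrow> int) \<Rightarrow> 'a poly fract \<Rightarrow> real" where
  "abs_place v a =
     (if a = 0 then 0 else real CARD('a) powi (- (int (place_degree v) * v a)))"

definition log_abs_place ::
  "('a::{field, finite} poly fract \<Rightarrow> int) \<Rightarrow> 'a poly fract \<Rightarrow> ereal" where
  "log_abs_place v a = (if a = 0 then -\<infinity> else ereal (ln (abs_place v a)))"

text \<open>
  For \<open>x \<noteq> 0\<close> the maximum is finite at every place and zero at almost every place, so the
  infinite sum has finite support.
\<close>

definition height_ff_vec ::
  "('n::finite \<Rightarrow> nat) \<Rightarrow> 'a::{field, finite} poly fract ^ 'n \<Rightarrow> real" where
  "height_ff_vec w x =
     (\<Sum>\<^sub>\<infinity>v\<in>places.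
        real_of_ereal (Max (range (\<lambda>i. log_abs_place v (x $ i) / ereal (real (w i))))))"

text \<open>By the product formula, the choice of the representative over \<open>K\<close> is immaterial.\<close>

definition height_ff ::
  "('n::finite \<Rightarrow> nat) \<Rightarrow> ('a::{field, finite} poly fract alg_closure ^ 'n) set \<Rightarrow> real" where
  "height_ff w P = height_ff_vec w (SOME x. geometric_vec x \<in> P)"

definition stack_height_ff ::
  "('n::finite \<Rightarrow> nat) \<Rightarrow> ('a::{field, finite} poly fract alg_closure ^ 'n) set \<Rightarrow> real" where
  "stack_height_ff w P = real (aut_order w P) * height_ff w P"

end

theory Submission
  imports Defs
begin

text \<open>
  Write \<open>w = d w'\<close>. A scalar \<open>c\<close> acts for the weights \<open>w\<close> as \<open>c\<^sup>d\<close> acts for \<open>w'\<close>, and over an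
  algebraically closed field every scalar is a \<open>d\<close>-th power. So both weights have the same orbits
  (\<open>wrel_scale_weights\<close>), and corresponding points are equal as sets of representatives
  (\<open>corresponding_scale_weights_eq\<close>). Whatever depends only on this set, such as the support, the
  minimal field of definition and the representative that the heights select, is therefore common
  to both sides.

  The weights enter in two more places. The order of the stabilizer is a gcd of weights, so it is
  multiplied by \<open>d\<close> when \<open>w'\<close> is replaced by \<open>w\<close> (\<open>aut_order_scale_weights\<close>). Each height is built
  from quotients by the weights, degrees in one case and logarithms in the other, so it is divided
  by \<open>d\<close>
  (\<open>height_deg_scale_weights\<close>, \<open>height_ff_scale_weights\<close>). The two factors cancel in the product.
\<close>

section \<open>Orbits under scaled weights\<close>

lemma equiv_wrel: "equiv (UNIV - {0}) (wrel w)"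
proof (rule equivI)
  show "wrel w \<subseteq> (UNIV - {0}) \<times> (UNIV - {0})"
    by (auto simp: wrel_def)
  show "refl_on (UNIV - {0}) (wrel w)"
    by (rule refl_onI) (auto simp: wrel_def intro: exI[of _ 1])
  show "sym (wrel w)"
  proof (rule symI)
    fix x y assume "(x, y) \<in> wrel w"
    then obtain c where "x \<noteq> 0" "y \<noteq> 0" "c \<noteq> 0" "\<forall>i. y $ i = c ^ w i * x $ i"
      by (auto simp: wrel_def)
    then have "inverse c \<noteq> 0 \<and> (\<forall>i. x $ i = inverse c ^ w i * y $ i)"
      by (simp add: power_inverse field_simps)
    with \<open>x \<noteq> 0\<close> \<open>y \<noteq> 0\<close> show "(y, x) \<in> wrel w"
      unfolding wrel_def by blast
  qed
  show "trans (wrel w)"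
  proof (rule transI)
    fix x y z assume "(x, y) \<in> wrel w" "(y, z) \<in> wrel w"
    then obtain b c where "x \<noteq> 0" "z \<noteq> 0" "b \<noteq> 0" "c \<noteq> 0"
      "\<forall>i. y $ i = b ^ w i * x $ i" "\<forall>i. z $ i = c ^ w i * y $ i"
      by (auto simp: wrel_def)
    then have "c * b \<noteq> 0 \<and> (\<forall>i. z $ i = (c * b) ^ w i * x $ i)"
      by (simp add: power_mult_distrib mult.assoc)
    with \<open>x \<noteq> 0\<close> \<open>z \<noteq> 0\<close> show "(x, z) \<in> wrel w"
      unfolding wrel_def by blast
  qed
qed

text \<open>
  Over an algebraically closed field the substitution \<open>c \<mapsto> c\<^sup>d\<close> is onto. It serves both for the
  scalars that define the orbits and for the scalars that the degree-based height minimizes over.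
\<close>

lemma ex_nonzero_scalar_power_iff:
  fixes Q :: "'k::alg_closed_field \<Rightarrow> bool"
  assumes "0 < d"
  shows "(\<exists>c. c \<noteq> 0 \<and> Q (c ^ d)) \<longleftrightarrow> (\<exists>c. c \<noteq> 0 \<and> Q c)"
proof
  assume "\<exists>c. c \<noteq> 0 \<and> Q c"
  then obtain c where "c \<noteq> 0" "Q c" by blast
  moreover obtain e where "e ^ d = c"
    using nth_root_exists[OF assms] by blast
  ultimately show "\<exists>c. c \<noteq> 0 \<and> Q (c ^ d)"
    using assms by (intro exI[of _ e]) auto
next
  assume "\<exists>c. c \<noteq> 0 \<and> Q (c ^ d)"
  then obtain c where "c \<noteq> 0" "Q (c ^ d)" by blast
  then show "\<exists>c. c \<noteq> 0 \<and> Q c"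
    by (intro exI[of _ "c ^ d"]) simp
qed

lemma wrel_scale_weights:
  assumes "0 < d"
  shows "(wrel (\<lambda>i. d * w i) :: (('k::alg_closed_field ^ 'n::finite) \<times> _) set) = wrel w"
proof -
  have "(\<exists>c. c \<noteq> 0 \<and> (\<forall>i. y $ i = c ^ (d * w i) * x $ i))
      \<longleftrightarrow> (\<exists>c. c \<noteq> 0 \<and> (\<forall>i. y $ i = c ^ w i * x $ i))" for x y :: "'k ^ 'n"
    using ex_nonzero_scalar_power_iff[OF assms, of "\<lambda>c. \<forall>i. y $ i = c ^ w i * x $ i"]
    by (simp add: power_mult)
  then show ?thesis
    by (simp add: wrel_def)
qed

lemma corresponding_scale_weights_eq:
  fixes P P' :: "('k::alg_closed_field ^ 'n::finite) set"
  assumes "0 < d" "P \<in> wproj (\<lambda>i. d * w i)" "P' \<in> wproj w" "corresponding P P'"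
  shows "P' = P"
proof -
  have "P \<in> (UNIV - {0}) // wrel w" "P' \<in> (UNIV - {0}) // wrel w"
    using assms(2,3) by (simp_all add: wproj_def wrel_scale_weights[OF assms(1)])
  from quotient_disj[OF equiv_wrel this] assms(4) show ?thesis
    by (auto simp: corresponding_def)
qed

section \<open>Scaling of the stabilizer and of the heights\<close>

lemma aut_order_scale_weights: "aut_order (\<lambda>i. d * w i) P = d * aut_order w P"
proof -
  have "Gcd ((*) d ` (w ` supp P)) = normalize (d * Gcd (w ` supp P))"
    by (rule Gcd_mult)
  then show ?thesis
    by (simp add: aut_order_def image_image)
qed

lemma ex_minimum_if_multiples_Nats:
  fixes A :: "real set"
  assumes "A \<noteq> {}" "0 < N" "\<And>a. a \<in> A \<Longrightarrow> N * a \<in> \<nat>"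
  shows "\<exists>m\<in>A. \<forall>a\<in>A. m \<le> a"
proof -
  define k where "k = (\<lambda>a. nat \<lfloor>N * a\<rfloor>)"
  have k: "N * a = real (k a)" if "a \<in> A" for a
    using assms(3)[OF that] by (auto simp: k_def elim: Nats_cases)
  obtain m where m: "m \<in> A" "\<forall>a. a \<in> A \<longrightarrow> k m \<le> k a"
    using assms(1) ex_has_least_nat[of "\<lambda>a. a \<in> A" _ k] by blast
  have "m \<le> a" if "a \<in> A" for a
  proof -
    have "N * m \<le> N * a"
      using m that by (simp add: k)
    then show ?thesis using assms(2) by simp
  qed
  with m(1) show ?thesis by blast
qed

text \<open>
  On the reals \<open>LEAST\<close> is a definite description, which is unspecified for a set without a minimum.
  So it commutes with a scaling only if the minimum is attained.
\<close>

lemma Least_scale: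
  fixes A :: "real set"
  assumes "0 < c" "\<exists>m\<in>A. \<forall>a\<in>A. m \<le> a"
  shows "(LEAST h. h \<in> (*) c ` A) = c * (LEAST h. h \<in> A)"
proof -
  obtain m where m: "m \<in> A" "\<forall>a\<in>A. m \<le> a"
    using assms(2) by blast
  have "(LEAST h. h \<in> A) = m"
    using m by (intro Least_equality) auto
  moreover have "(LEAST h. h \<in> (*) c ` A) = c * m"
    using m assms(1) by (intro Least_equality) auto
  ultimately show ?thesis by simp
qed

definition scaled_degree ::
  "('n::finite \<Rightarrow> nat) \<Rightarrow> 'a::{field, finite} alg_closure ^ 'n \<Rightarrow> 'a alg_closure \<Rightarrow> real" where
  "scaled_degree w x c = Max (range (\<lambda>i. real (field_degree (c ^ w i * x $ i)) / real (w i)))"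

lemma min_scaled_degree_eq_Least:
  "min_scaled_degree w x = (LEAST h. h \<in> scaled_degree w x ` (UNIV - {0}))"
  unfolding min_scaled_degree_def scaled_degree_def
  by (rule arg_cong[where f = Least]) (auto simp: fun_eq_iff)

text \<open>The product of the weights is a common denominator of all the quotients.\<close>

lemma ex_minimum_scaled_degree:
  fixes x :: "'a::{field, finite} alg_closure ^ 'n::finite"
  assumes "\<And>i. 0 < w i"
  shows "\<exists>m\<in>scaled_degree w x ` (UNIV - {0}). \<forall>a\<in>scaled_degree w x ` (UNIV - {0}). m \<le> a"
proof (rule ex_minimum_if_multiples_Nats)
  show "scaled_degree w x ` (UNIV - {0}) \<noteq> {}"
  proof -
    have "(1 :: 'a alg_closure) \<in> UNIV - {0}" by simp
    then show ?thesis by blast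
  qed
  show "0 < real (\<Prod>i\<in>UNIV. w i)"
    using assms by (simp add: prod_pos)
  fix a assume "a \<in> scaled_degree w x ` (UNIV - {0})"
  then obtain c where "a = scaled_degree w x c" by blast
  moreover have "scaled_degree w x c
      \<in> range (\<lambda>i. real (field_degree (c ^ w i * x $ i)) / real (w i))"
    unfolding scaled_degree_def by (rule Max_in) auto
  ultimately obtain i where a: "a = real (field_degree (c ^ w i * x $ i)) / real (w i)"
    by blast
  have "(\<Prod>j\<in>UNIV. w j) = w i * (\<Prod>j\<in>UNIV - {i}. w j)"
    by (rule prod.remove) auto
  then have "real (\<Prod>j\<in>UNIV. w j) * a
      = real ((\<Prod>j\<in>UNIV - {i}. w j) * field_degree (c ^ w i * x $ i))"
    using assms[of i] by (simp add: a del: of_nat_prod)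
  then show "real (\<Prod>j\<in>UNIV. w j) * a \<in> \<nat>"
    by (metis of_nat_in_Nats)
qed

lemma scaled_degree_scale_weights:
  assumes "0 < d"
  shows "scaled_degree w x (c ^ d) = real d * scaled_degree (\<lambda>i. d * w i) x c"
proof -
  have "mono ((*) (real d))"
    by (simp add: mono_def mult_left_mono)
  then have "real d * scaled_degree (\<lambda>i. d * w i) x c
      = Max ((*) (real d) `
          range (\<lambda>i. real (field_degree (c ^ (d * w i) * x $ i)) / real (d * w i)))"
    unfolding scaled_degree_def by (rule mono_Max_commute) auto
  also have "\<dots> = scaled_degree w x (c ^ d)"
    using assms by (simp add: scaled_degree_def image_image power_mult)
  finally show ?thesis by simp
qed

lemma min_scaled_degree_scale_weights:
  assumes "0 < d" "\<And>i. 0 < w i"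
  shows "min_scaled_degree w x = real d * min_scaled_degree (\<lambda>i. d * w i) x"
proof -
  let ?A = "scaled_degree (\<lambda>i. d * w i) x ` (UNIV - {0})"
  have "h \<in> scaled_degree w x ` (UNIV - {0}) \<longleftrightarrow> h \<in> (*) (real d) ` ?A" for h
    using ex_nonzero_scalar_power_iff[OF assms(1), of "\<lambda>c. h = scaled_degree w x c"]
    by (auto simp: scaled_degree_scale_weights[OF assms(1)])
  moreover have "\<exists>m\<in>?A. \<forall>a\<in>?A. m \<le> a"
    using assms by (intro ex_minimum_scaled_degree) simp
  ultimately show ?thesis
    using Least_scale[of "real d" ?A] assms(1) by (simp add: min_scaled_degree_eq_Least)
qed

lemma height_deg_scale_weights:
  assumes "0 < d" "\<And>i. 0 < w i"
  shows "height_deg w P = real d * height_deg (\<lambda>i. d * w i) P"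
  unfolding height_deg_def by (subst min_scaled_degree_scale_weights[OF assms]) (simp_all only: mult.left_commute)

text \<open>
  The factor \<open>d\<close> comes out of the extended real maximum at each place and then out of the sum over
  all places. The two heights use the same representative over \<open>K\<close>, because the choice depends
  only on \<open>P\<close>.
\<close>

lemma height_ff_scale_weights:
  assumes "0 < d" "\<And>i. 0 < w i"
  shows "height_ff w P = real d * height_ff (\<lambda>i. d * w i) P"
proof -
  have local_term: "real_of_ereal (Max (range (\<lambda>i. log_abs_place v (x $ i) / ereal (real (w i)))))
      = real d * real_of_ereal
          (Max (range (\<lambda>i. log_abs_place v (x $ i) / ereal (real (d * w i)))))" for v x
  proof -
    have quotient: "ereal (real d) * (log_abs_place v (x $ i) / ereal (real (d * w i)))
        = log_abs_place v (x $ i) / ereal (real (w i))" for i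
      using assms(1) assms(2)[of i]
      by (cases "x $ i = 0") (simp_all add: log_abs_place_def divide_ereal_def)
    have "mono ((*) (ereal (real d)))"
      by (auto simp: mono_def intro: ereal_mult_left_mono)
    then have "ereal (real d) * Max (range (\<lambda>i. log_abs_place v (x $ i) / ereal (real (d * w i))))
        = Max ((*) (ereal (real d)) `
            range (\<lambda>i. log_abs_place v (x $ i) / ereal (real (d * w i))))"
      by (rule mono_Max_commute) auto
    also have "\<dots> = Max (range (\<lambda>i. log_abs_place v (x $ i) / ereal (real (w i))))"
      by (simp only: image_image quotient)
    finally show ?thesis
      by (metis real_of_ereal.simps(1) real_of_ereal_mult)
  qed
  show ?thesis
    unfolding height_ff_def height_ff_vec_def
    by (subst local_term) (rule infsum_cmult_right')
qed

section \<open>Invariance of the stacky heights\<close>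

theorem proposition5p4:
  fixes w w' :: "'n::finite \<Rightarrow> nat"
    and d :: nat
    and f :: "('n, 'a::{field, finite}) mpolynomial"
  assumes "\<And>i. 0 < w i"
    and "f \<noteq> 0"
    and "weighted_homogeneous w f"
    and "d = Gcd (range w)"
    and "w' = (\<lambda>i. w i div d)"
  shows "(\<forall>P \<in> hypersurface_Fqbar w f. \<forall>P' \<in> hypersurface_Fqbar w' f.
            corresponding P P' \<longrightarrow> stack_height_deg w' P' = stack_height_deg w P) \<and>
         (\<forall>Q \<in> hypersurface_K w f. \<forall>Q' \<in> hypersurface_K w' f.
            corresponding Q Q' \<longrightarrow> stack_height_ff w' Q' = stack_height_ff w Q)"
proof -
  have dvd: "d dvd w i" for i
    using assms(4) by simp
  then have "0 < d"
    using assms(1) by (meson dvd_pos_nat)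
  have w: "w = (\<lambda>i. d * w' i)"
    using dvd by (simp add: assms(5))
  have w'_pos: "0 < w' i" for i
    using assms(1)[of i] w by (metis nat_0_less_mult_iff)
  show ?thesis
  proof (intro conjI ballI impI)
    fix P P'
    assume "P \<in> hypersurface_Fqbar w f" "P' \<in> hypersurface_Fqbar w' f" "corresponding P P'"
    then have "P' = P"
      using corresponding_scale_weights_eq[OF \<open>0 < d\<close>, of P w' P'] w
      by (simp add: hypersurface_Fqbar_def hypersurface_points_def)
    then show "stack_height_deg w' P' = stack_height_deg w P"
      using height_deg_scale_weights[OF \<open>0 < d\<close> w'_pos, where P = P]
      by (simp add: stack_height_deg_def w aut_order_scale_weights)
  next
    fix Q Q'
    assume "Q \<in> hypersurface_K w f" "Q' \<in> hypersurface_K w' f" "corresponding Q Q'"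
    then have "Q' = Q"
      using corresponding_scale_weights_eq[OF \<open>0 < d\<close>, of Q w' Q'] w
      by (simp add: hypersurface_K_def hypersurface_points_def)
    then show "stack_height_ff w' Q' = stack_height_ff w Q"
      using height_ff_scale_weights[OF \<open>0 < d\<close> w'_pos, where P = Q]
      by (simp add: stack_height_ff_def w aut_order_scale_weights)
  qed
qed

end
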